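(* Let $\mathfrak{D}=\sum_{i=0}^m\Delta_i\otimes V(\ell_i)$ where each $\ell_i$ is a linear form in $\mathbb{C}[x_0,\dots,x_c]$, the $\Delta_i$ are rational polyhedra with common tail cone $\sigma$, $\sum_i\Delta_i\subsetneq\sigma$, and the hyperplane arrangement $\{V(\ell_i)\}$ is of full rank and in general linear position. Let $w\in\mathrm{relint}(\tau)$ where $\tau$ is a maximal cone of $\mathrm{Trop}(L)$, $L$ being the image of $\mathbb{P}^c$ in $\mathbb{P}^m$ under $P\mapsto[\ell_0(P):\dots:\ell_m(P)]$. Let $\mathcal{I}\subseteq\{0,\dots,m\}$ be the set of indices at which $w$ is minimized, $\{i_1,\dots,i_c\}=\{0,\dots,m\}\setminus\mathcal{I}$, and $$S_w=\Big\{(v,u)\in\mathbb{Z}^c\times(\sigma^\vee\cap M)\ :\ \sum_{i=1}^cv_i\le\sum_{j\in\mathcal{I}}\lfloor\Delta_j(u)\rfloor\ \text{ and }\ v_j\ge-\lfloor\Delta_{i_j}(u)\rfloor\ \text{ for all }1\le j\le c\Big\}.$$ Then the semigroup $S_w$ is saturated (in $\mathbb{Z}^c\times M$) if and only if the collection $\{\Delta_i\}_{i\in\mathcal{I}}$ is admissible.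
   Context: $N$ is a lattice of finite rank, $M=\mathrm{Hom}(N,\mathbb{Z})$, $\sigma\subset N_{\mathbb{Q}}$ a pointed rational polyhedral cone with dual $\sigma^\vee$. The $\Delta_i$ have the form $\Pi_i+\sigma$ with $\Pi_i\subset N_{\mathbb{Q}}$ a nonempty rational polytope, and $\Delta_i(u)=\min_{v\in\Delta_i}\langle u,v\rangle$ for $u\in\sigma^\vee$. Full rank and general linear position: any $c+1$ of the $\ell_i$ are linearly independent, and the $\ell_i$ span the linear forms. $\mathrm{Trop}(L)\subset\mathbb{R}^m\cong\mathbb{R}^{m+1}/\mathbb{R}(1,\dots,1)$ is the (min-convention) tropicalization of $L\cap T_{\mathbb{P}^m}$, the Bergman fan of the uniform matroid $U_{c+1,m+1}$, with maximal cones $\mathrm{cone}(e_{i_1},\dots,e_{i_c})$ for $c$-subsets of $\{0,\dots,m\}$ ($e_1,\dots,e_m$ standard basis, $e_0=-\sum_{i\ge1}e_i$); $w=(w_1,\dots,w_m)$ is read as $(w_0=0,w_1,\dots,w_m)$ and $\mathcal{I}=\{i:w_i=\min_kw_k\}$, which has $m-c+1$ elements. A collection $\{\Delta_i\}$ of rational polyhedra with common tail cone $\sigma$ is admissible if for each $u\in\sigma^\vee\cap M$ at most one of the faces $\mathrm{face}(\Delta_i,u)$ is non-integral, where $\mathrm{face}(\Delta,u)$ is the face of $\Delta$ on which $u$ is minimized and a face is non-integral if it contains no point of the lattice $N$. A semigroup $S\subseteq\mathbb{Z}^c\times M$ is saturated if $k(v,u)\in S$ for some integer $k\ge1$ and $(v,u)\in\mathbb{Z}^c\times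 M$ imply $(v,u)\in S$. *)

theory Defs
  imports "HOL-Analysis.Analysis" "HOL-Library.Poly_Mapping"
begin

text \<open>
  After a choice of basis, \<open>N = M = \<int>\<^sup>n\<close> is the type \<open>int ^ 'n\<close> and the rational spaces
  \<open>N\<^sub>\<rat>\<close>, \<open>M\<^sub>\<rat>\<close> are \<open>rat ^ 'n\<close>, paired by the dot product.
  The index set \<open>{0, \<dots>, m}\<close> is \<open>'m option\<close> with \<open>CARD('m) = m\<close>, where \<open>None\<close> is the index
  \<open>0\<close>; likewise the variables \<open>x\<^sub>0, \<dots>, x\<^sub>c\<close> are indexed by \<open>'c option\<close> with \<open>CARD('c) = c\<close>.
  In particular \<open>c \<ge> 1\<close>: for \<open>c = 0\<close> the loci \<open>V(l\<^sub>i)\<close> are empty.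
\<close>

definition lattice_emb :: "int ^ 'n \<Rightarrow> rat ^ 'n" where
  "lattice_emb z = (\<chi> i. of_int (z $ i))"

definition pairing :: "rat ^ 'n \<Rightarrow> rat ^ 'n \<Rightarrow> rat" where
  "pairing u v = (\<Sum>i\<in>UNIV. u $ i * v $ i)"

definition rat_cone :: "(rat ^ 'n) set \<Rightarrow> (rat ^ 'n) set" where
  "rat_cone G = {\<Sum>g\<in>G. a g *s g |a. \<forall>g\<in>G. 0 \<le> a g}"

definition rat_polytope :: "(rat ^ 'n) set \<Rightarrow> (rat ^ 'n) set" where
  "rat_polytope P = {\<Sum>p\<in>P. a p *s p |a. (\<forall>p\<in>P. 0 \<le> a p) \<and> (\<Sum>p\<in>P. a p) = 1}"

definition polyhedral_cone :: "(rat ^ 'n) set \<Rightarrow> bool" where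
  "polyhedral_cone \<sigma> \<longleftrightarrow> (\<exists>G. finite G \<and> \<sigma> = rat_cone G)"

definition pointed :: "(rat ^ 'n) set \<Rightarrow> bool" where
  "pointed \<sigma> \<longleftrightarrow> \<sigma> \<inter> uminus ` \<sigma> = {0}"

definition dual_cone :: "(rat ^ 'n) set \<Rightarrow> (rat ^ 'n) set" where
  "dual_cone \<sigma> = {u. \<forall>v\<in>\<sigma>. 0 \<le> pairing u v}"

text \<open>The sum of sets is the Minkowski sum.\<close>

definition polyhedron_with_tail :: "(rat ^ 'n) set \<Rightarrow> (rat ^ 'n) set \<Rightarrow> bool" where
  "polyhedron_with_tail \<sigma> \<Delta> \<longleftrightarrow>
     (\<exists>P. finite P \<and> P \<noteq> {} \<and> \<Delta> = rat_polytope P + \<sigma>)"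

text \<open>
  \<open>\<Delta>(u) = min\<^sub>v \<langle>u, v\<rangle>\<close>. The minimum exists when \<open>u\<close> lies in the dual of the tail cone, the
  only case in which the value is used.
\<close>

definition support_value :: "(rat ^ 'n) set \<Rightarrow> int ^ 'n \<Rightarrow> rat" where
  "support_value \<Delta> u = (LEAST t. t \<in> pairing (lattice_emb u) ` \<Delta>)"

definition min_face :: "(rat ^ 'n) set \<Rightarrow> int ^ 'n \<Rightarrow> (rat ^ 'n) set" where
  "min_face \<Delta> u =
     {v \<in> \<Delta>. \<forall>v'\<in>\<Delta>. pairing (lattice_emb u) v \<le> pairing (lattice_emb u) v'}"

definition nonintegral :: "(rat ^ 'n) set \<Rightarrow> bool" where
  "nonintegral F \<longleftrightarrow> F \<inter> range lattice_emb = {}"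

text \<open>
  The collection is a family indexed by \<open>I\<close>: equal polyhedra at different indices are
  counted separately.
\<close>

definition admissible :: "(rat ^ 'n) set \<Rightarrow> 'i set \<Rightarrow> ('i \<Rightarrow> (rat ^ 'n) set) \<Rightarrow> bool" where
  "admissible \<sigma> I \<Delta> \<longleftrightarrow>
     (\<forall>u. lattice_emb u \<in> dual_cone \<sigma> \<longrightarrow>
        (\<forall>i\<in>I. \<forall>j\<in>I. nonintegral (min_face (\<Delta> i) u) \<longrightarrow>
                      nonintegral (min_face (\<Delta> j) u) \<longrightarrow> i = j))"

definition saturated :: "((int ^ 'c) \<times> (int ^ 'n)) set \<Rightarrow> bool" where
  "saturated S \<longleftrightarrow> (\<forall>v u k. 1 \<le> k \<longrightarrow> (k *s v, k *s u) \<in> S \<longrightarrow> (v, u) \<in> S)"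

text \<open>A linear form in \<open>\<complex>[x\<^sub>0, \<dots>, x\<^sub>c]\<close> is given by its vector of coefficients.\<close>

definition form_eval :: "complex ^ 'k \<Rightarrow> complex ^ 'k \<Rightarrow> complex" where
  "form_eval f x = (\<Sum>i\<in>UNIV. f $ i * x $ i)"

definition general_position :: "('m::finite option \<Rightarrow> complex ^ 'c::finite option) \<Rightarrow> bool" where
  "general_position l \<longleftrightarrow>
     (\<forall>J. card J = CARD('c) + 1 \<longrightarrow> inj_on l J \<and> vec.independent (l ` J))"

definition full_rank :: "('m::finite option \<Rightarrow> complex ^ 'c::finite option) \<Rightarrow> bool" where
  "full_rank l \<longleftrightarrow> vec.span (range l) = UNIV"

text \<open>
  The points of \<open>L\<close> in the torus of \<open>P\<^sup>m\<close>, in the torus coordinates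
  \<open>y\<^sub>j = X\<^sub>j / X\<^sub>0\<close>, \<open>1 \<le> j \<le> m\<close>, where \<open>X\<^sub>0, \<dots>, X\<^sub>m\<close> are the homogeneous coordinates.
\<close>

definition torus_part :: "('m::finite option \<Rightarrow> complex ^ 'c::finite option) \<Rightarrow> (complex ^ 'm) set" where
  "torus_part l =
     {\<chi> j. form_eval (l (Some j)) x / form_eval (l None) x |x. \<forall>i. form_eval (l i) x \<noteq> 0}"

text \<open>Laurent polynomials in \<open>m\<close> variables as finitely supported maps on the exponents.\<close>

type_synonym 'm laurent = "(int ^ 'm, complex) poly_mapping"

definition laurent_eval :: "'m::finite laurent \<Rightarrow> complex ^ 'm \<Rightarrow> complex" where
  "laurent_eval f y =
     (\<Sum>a\<in>Poly_Mapping.keys f. Poly_Mapping.lookup f a * (\<Prod>j\<in>UNIV. y $ j powi a $ j))"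

definition weight :: "real ^ 'm \<Rightarrow> int ^ 'm \<Rightarrow> real" where
  "weight w a = (\<Sum>j\<in>UNIV. w $ j * of_int (a $ j))"

definition initial_exponents :: "real ^ 'm \<Rightarrow> 'm::finite laurent \<Rightarrow> (int ^ 'm) set" where
  "initial_exponents w f =
     {a \<in> Poly_Mapping.keys f. \<forall>b\<in>Poly_Mapping.keys f. weight w a \<le> weight w b}"

text \<open>
  Tropicalization (min convention, trivial valuation) of a subset of the torus: the
  intersection of the tropical hypersurfaces of all nonzero Laurent polynomials in its ideal.
\<close>

definition tropicalization :: "(complex ^ 'm::finite) set \<Rightarrow> (real ^ 'm) set" where
  "tropicalization Y =
     {w. \<forall>f. f \<noteq> 0 \<longrightarrow> (\<forall>y\<in>Y. laurent_eval f y = 0) \<longrightarrow> 2 \<le> card (initial_exponents w f)}"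

definition ray :: "'m option \<Rightarrow> real ^ 'm::finite" where
  "ray i = (case i of None \<Rightarrow> - (\<Sum>j\<in>UNIV. axis j 1) | Some j \<Rightarrow> axis j 1)"

definition ray_cone :: "'m option set \<Rightarrow> (real ^ 'm::finite) set" where
  "ray_cone J = convex_cone hull (ray ` J)"

text \<open>
  The fan structure on \<open>Trop(L)\<close>: its cones are the cones of the fan of \<open>P\<^sup>m\<close> (hence \<open>J\<close> is a
  proper subset of the index set) that are contained in it. For \<open>l\<close> of full rank and in
  general position the maximal cones are those spanned by \<open>c\<close> of the \<open>m + 1\<close> rays, and the
  fan is the Bergman fan of the uniform matroid \<open>U\<^sub>c\<^sub>+\<^sub>1\<^sub>,\<^sub>m\<^sub>+\<^sub>1\<close>.
\<close>

definition trop_fan :: "('m::finite option \<Rightarrow> complex ^ 'c::finite option) \<Rightarrow> (real ^ 'm) set set" where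
  "trop_fan l = {ray_cone J |J. J \<noteq> UNIV \<and> ray_cone J \<subseteq> tropicalization (torus_part l)}"

definition maximal_trop_cone ::
  "('m::finite option \<Rightarrow> complex ^ 'c::finite option) \<Rightarrow> (real ^ 'm) set \<Rightarrow> bool" where
  "maximal_trop_cone l \<tau> \<longleftrightarrow> \<tau> \<in> trop_fan l \<and> (\<forall>\<tau>'\<in>trop_fan l. \<tau> \<subseteq> \<tau>' \<longrightarrow> \<tau>' = \<tau>)"

definition hom_coord :: "real ^ 'm \<Rightarrow> 'm option \<Rightarrow> real" where
  "hom_coord w i = (case i of None \<Rightarrow> 0 | Some j \<Rightarrow> w $ j)"

definition min_indices :: "real ^ 'm \<Rightarrow> 'm option set" where
  "min_indices w = {i. \<forall>k. hom_coord w i \<le> hom_coord w k}"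

text \<open>Here \<open>idx\<close> is the enumeration \<open>i\<^sub>1, \<dots>, i\<^sub>c\<close> of the complement of \<open>min_indices w\<close>.\<close>

definition S_w :: "(rat ^ 'n) set \<Rightarrow> ('m::finite option \<Rightarrow> (rat ^ 'n) set) \<Rightarrow> real ^ 'm \<Rightarrow>
    ('c::finite \<Rightarrow> 'm option) \<Rightarrow> ((int ^ 'c) \<times> (int ^ 'n)) set" where
  "S_w \<sigma> \<Delta> w idx =
     {(v, u). lattice_emb u \<in> dual_cone \<sigma> \<and>
        (\<Sum>j\<in>UNIV. v $ j) \<le> (\<Sum>i\<in>min_indices w. \<lfloor>support_value (\<Delta> i) u\<rfloor>) \<and>
        (\<forall>j. v $ j \<ge> - \<lfloor>support_value (\<Delta> (idx j)) u\<rfloor>)}"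

end

theory Submission
  imports Defs
begin

text \<open>
  The lower bounds \<open>v\<^sub>j \<ge> - \<lfloor>\<Delta>\<^sub>i(u)\<rfloor>\<close> (with \<open>i = i\<^sub>j\<close>) say the same as
  \<open>v\<^sub>j \<ge> - \<Delta>\<^sub>i(u)\<close>, because \<open>v\<^sub>j\<close> is an integer, and this condition is homogeneous. So only the
  upper bound on the sum of the \<open>v\<^sub>j\<close> can obstruct saturation. For a multiple of \<open>(v, u)\<close> clearing
  the denominators it says that the sum is at most \<open>\<lfloor>\<Sum>\<^sub>I \<Delta>\<^sub>i(u)\<rfloor>\<close>, for \<open>(v, u)\<close> itself that it is
  at most \<open>\<Sum>\<^sub>I \<lfloor>\<Delta>\<^sub>i(u)\<rfloor>\<close>, where \<open>I\<close> is the set of indices minimizing \<open>w\<close>.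

  If the family is admissible, then in every degree at most one \<open>\<Delta>\<^sub>i(u)\<close> with \<open>i \<in> I\<close> is not an
  integer, and the two bounds agree (\<open>admissible_imp_saturated\<close>).

  Conversely, saturation forces the two bounds to agree in each degree where some \<open>v\<close> attains the
  weaker one, and such a \<open>v\<close> exists as soon as \<open>\<Sum>\<^sub>i \<Delta>\<^sub>i(u)\<close>, taken over all indices, is large
  (\<open>saturated_imp_floor_sum_le\<close>). A family that is not admissible is refuted by constructing a
  degree of this kind where the bounds differ. Let the faces of two polyhedra in direction
  \<open>u\<close> be non-integral. Since the tail cone is pointed, some functional is strictly positive on it
  (\<open>gordan\<close>), and a generic small perturbation \<open>u'\<close> of \<open>u\<close> towards it is minimized on each
  \<open>\<Delta>\<^sub>k\<close> at a single vertex \<open>p\<^sub>k\<close> of the face in direction \<open>u\<close> (\<open>generic_refinement\<close>). Two of these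
  vertices, \<open>p\<^sub>i\<close> and \<open>p\<^sub>j\<close>, are not lattice points, so for a suitable \<open>a\<close> the
  fractional parts of \<open>\<langle>a, p\<^sub>i\<rangle>\<close> and \<open>\<langle>a, p\<^sub>j\<rangle>\<close> add up to at least \<open>1\<close>
  (\<open>large_fractional_parts\<close>). Adding to \<open>a\<close> a large and sufficiently divisible multiple of
  \<open>u'\<close> keeps the fractional parts and reaches the open cone of functionals that select the same
  vertices, where \<open>\<Delta>\<^sub>k\<close> is given by pairing with \<open>p\<^sub>k\<close>. There the two bounds
  differ. The sum of all support values also grows without bound along \<open>u'\<close>: it is the pairing
  with \<open>\<Sum>\<^sub>k p\<^sub>k\<close>, an element of \<open>\<sigma>\<close> which is nonzero because \<open>\<Sum>\<^sub>k \<Delta>\<^sub>k\<close> is a proper subset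
  of \<open>\<sigma>\<close> (\<open>zero_notin_Minkowski_sum\<close>).
\<close>

section \<open>The rational pairing\<close>

lemma pairing_add_left: "pairing (u + u') v = pairing u v + pairing u' v"
  by (simp add: pairing_def distrib_right sum.distrib)

lemma pairing_add_right: "pairing u (v + v') = pairing u v + pairing u v'"
  by (simp add: pairing_def distrib_left sum.distrib)

lemma pairing_diff_right: "pairing u (v - v') = pairing u v - pairing u v'"
  by (simp add: pairing_def right_diff_distrib sum_subtractf)

lemma pairing_scale_left: "pairing (a *s u) v = a * pairing u v"
  by (simp add: pairing_def sum_distrib_left mult.assoc)

lemma pairing_scale_right: "pairing u (a *s v) = a * pairing u v"
  by (simp add: pairing_def sum_distrib_left mult.left_commute)

lemma pairing_zero_right [simp]: "pairing u 0 = 0"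
  by (simp add: pairing_def)

lemma pairing_sum_right: "pairing u (\<Sum>i\<in>A. f i) = (\<Sum>i\<in>A. pairing u (f i))"
  by (induction A rule: infinite_finite_induct) (auto simp: pairing_add_right)

lemmas pairing_linear = pairing_add_left pairing_add_right pairing_diff_right
  pairing_scale_left pairing_scale_right pairing_sum_right

lemma pairing_self_pos:
  assumes "h \<noteq> 0"
  shows "0 < pairing h h"
proof -
  obtain i where "h $ i \<noteq> 0"
    using assms by (auto simp: vec_eq_iff)
  then have "0 < h $ i * h $ i"
    by (simp add: zero_less_mult_iff) linarith
  also have "\<dots> \<le> pairing h h"
    unfolding pairing_def by (rule member_le_sum) auto
  finally show ?thesis .
qed

lemma lattice_emb_add: "lattice_emb (x + y) = lattice_emb x + lattice_emb y"
  by (simp add: lattice_emb_def vec_eq_iff)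

lemma lattice_emb_uminus: "lattice_emb (- x) = (-1) *s lattice_emb x"
  by (simp add: lattice_emb_def vec_eq_iff)

lemma lattice_emb_scale: "lattice_emb (k *s x) = of_int k *s lattice_emb x"
  by (simp add: lattice_emb_def vec_eq_iff)

lemma pairing_lattice_Ints: "pairing (lattice_emb x) (lattice_emb y) \<in> \<int>"
  by (auto simp: pairing_def lattice_emb_def intro!: Ints_sum)

lemma common_denominator:
  fixes r :: "'i \<Rightarrow> rat"
  assumes "finite I"
  shows "\<exists>d::int. 0 < d \<and> (\<forall>i\<in>I. of_int d * r i \<in> \<int>)"
  using assms
proof (induction I rule: finite_induct)
  case empty
  show ?case by (auto intro: exI [of _ 1])
next
  case (insert x I)
  then obtain d :: int where d: "0 < d" "\<forall>i\<in>I. of_int d * r i \<in> \<int>"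
    by blast
  obtain a b where ab: "r x = of_int a / of_int b" "0 < b"
    by (metis Rat_cases Fract_of_int_quotient)
  have "of_int (d * b) * r i \<in> \<int>" if "i \<in> insert x I" for i
  proof (cases "i = x")
    case True
    then have "of_int (d * b) * r i = of_int (d * a)"
      using ab by simp
    then show ?thesis
      using Ints_of_int by metis
  next
    case False
    then have "of_int d * r i \<in> \<int>"
      using d that by simp
    then have "of_int b * (of_int d * r i) \<in> \<int>"
      by (rule Ints_mult [OF Ints_of_int])
    then show ?thesis
      by (simp add: ac_simps)
  qed
  then show ?case
    using d ab by (intro exI [of _ "d * b"]) auto
qed

lemma common_dominating_multiple:
  fixes b c :: "'i \<Rightarrow> rat"
  assumes "finite I"
  shows "\<exists>K::nat. 0 < K \<and> (\<forall>i\<in>I. 0 < b i \<longrightarrow> c i < of_nat K * b i)"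
proof -
  have "\<exists>K::nat. c i / b i < of_nat K" for i
    by (rule reals_Archimedean2)
  then obtain k :: "'i \<Rightarrow> nat" where k: "\<And>i. c i / b i < of_nat (k i)"
    by metis
  define K where "K = Suc (\<Sum>i\<in>I. k i)"
  have "c i < of_nat K * b i" if i: "i \<in> I" "0 < b i" for i
  proof -
    have "k i \<le> K"
      using member_le_sum [of i I k] assms i by (simp add: K_def)
    then have "c i / b i < of_nat K"
      using k [of i] by (meson less_le_trans of_nat_mono)
    then show ?thesis
      using i by (simp add: pos_divide_less_eq)
  qed
  then show ?thesis
    by (intro exI [of _ K]) (auto simp: K_def)
qed

section \<open>Strictly positive functionals\<close>

text \<open>
  Gordan's alternative over \<open>\<rat>\<close>. In the induction step a functional \<open>u\<close> positive on the old vectors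
  is corrected at the new vector \<open>h\<close>. If \<open>\<langle>u, h\<rangle> = 0\<close>, adding \<open>h\<close> itself to a large multiple
  of \<open>u\<close> suffices. If \<open>\<langle>u, h\<rangle> < 0\<close>, the old vectors are projected along \<open>h\<close> to the hyperplane
  \<open>u = 0\<close>; this adds positive multiples of \<open>h\<close>, so no relation is created, and a functional
  positive on the projections can be changed by a multiple of \<open>u\<close> without affecting them until
  it is slightly positive on \<open>h\<close>.
\<close>

lemma gordan:
  fixes g :: "'i \<Rightarrow> rat ^ 'n::finite"
  assumes "finite I"
    and "\<And>a. (\<forall>i\<in>I. 0 \<le> a i) \<Longrightarrow> (\<Sum>i\<in>I. a i *s g i) = 0 \<Longrightarrow> \<forall>i\<in>I. a i = 0"
  shows "\<exists>u. \<forall>i\<in>I. 0 < pairing u (g i)"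
  using assms
proof (induction I arbitrary: g rule: finite_induct)
  case empty
  show ?case by simp
next
  case (insert j I)
  define h where "h = g j"
  have sum_upd: "(\<Sum>i\<in>insert j I. (if i = j then b else a i) *s g i) = b *s h + (\<Sum>i\<in>I. a i *s g i)"
    for a b
  proof -
    have "(\<Sum>i\<in>I. (if i = j then b else a i) *s g i) = (\<Sum>i\<in>I. a i *s g i)"
      using insert.hyps by (intro sum.cong) auto
    then show ?thesis
      using insert.hyps by (simp add: h_def)
  qed
  have indep: "b = 0 \<and> (\<forall>i\<in>I. a i = 0)"
    if "0 \<le> b" "\<forall>i\<in>I. 0 \<le> a i" "b *s h + (\<Sum>i\<in>I. a i *s g i) = 0" for a b
  proof -
    have "\<forall>i\<in>insert j I. (if i = j then b else a i) = 0"
      using that by (intro insert.prems) (auto simp: sum_upd)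
    then show ?thesis
      using insert.hyps by (metis insertCI)
  qed
  have "\<exists>u. \<forall>i\<in>I. 0 < pairing u (g i)"
    using indep [of 0] by (intro insert.IH) auto
  then obtain u where u: "\<And>i. i \<in> I \<Longrightarrow> 0 < pairing u (g i)"
    by blast
  consider "0 < pairing u h" | "pairing u h = 0" | "pairing u h < 0"
    by linarith
  then show ?case
  proof cases
    case 1
    then show ?thesis
      using u by (auto simp: h_def intro: exI [of _ u])
  next
    case 2
    have "h \<noteq> 0"
      using indep [of 1 "\<lambda>_. 0"] by auto
    obtain K :: nat where K: "\<forall>i\<in>I. 0 < pairing u (g i) \<longrightarrow> - pairing h (g i) < of_nat K * pairing u (g i)"
      using common_dominating_multiple [OF insert.hyps(1), of "\<lambda>i. pairing u (g i)"
        "\<lambda>i. - pairing h (g i)"]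
      by blast
    have "0 < pairing (of_nat K *s u + h) (g i)" if "i \<in> insert j I" for i
    proof (cases "i = j")
      case True
      then show ?thesis
        using 2 pairing_self_pos [OF \<open>h \<noteq> 0\<close>] by (simp add: pairing_linear h_def)
    next
      case False
      then have "i \<in> I" using that by simp
      then have "- pairing h (g i) < of_nat K * pairing u (g i)"
        using K u by blast
      then show ?thesis
        by (simp add: pairing_linear)
    qed
    then show ?thesis by blast
  next
    case 3
    define c where "c i = - pairing u (g i) / pairing u h" for i
    have c_pos: "0 < c i" if "i \<in> I" for i
      using u [OF that] 3 by (simp add: c_def divide_pos_neg)
    define g' where "g' i = g i + c i *s h" for i
    have "\<exists>u. \<forall>i\<in>I. 0 < pairing u (g' i)"
    proof (intro insert.IH)
      fix a :: "'i \<Rightarrow> rat"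
      assume a: "\<forall>i\<in>I. 0 \<le> a i" and rel: "(\<Sum>i\<in>I. a i *s g' i) = 0"
      have "(\<Sum>i\<in>I. a i * c i) *s h + (\<Sum>i\<in>I. a i *s g i) = (\<Sum>i\<in>I. a i *s g' i)"
        by (simp add: g'_def vec_eq_iff sum.distrib sum_distrib_left algebra_simps)
      moreover have "0 \<le> (\<Sum>i\<in>I. a i * c i)"
        using a c_pos by (intro sum_nonneg mult_nonneg_nonneg) (auto intro: less_imp_le)
      ultimately show "\<forall>i\<in>I. a i = 0"
        using indep a rel by metis
    qed
    then obtain u' where u': "\<And>i. i \<in> I \<Longrightarrow> 0 < pairing u' (g' i)"
      by blast
    obtain K :: nat where K: "\<forall>i\<in>I. 0 < pairing u' (g' i) \<longrightarrow> c i < of_nat K * pairing u' (g' i)"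
      using common_dominating_multiple [OF insert.hyps(1), of "\<lambda>i. pairing u' (g' i)" c] by blast
    \<comment> \<open>The multiple of \<open>u\<close> is chosen to make the value at \<open>h\<close> equal to \<open>1\<close>.\<close>
    define s where "s = (1 - of_nat K * pairing u' h) / pairing u h"
    define f where "f = of_nat K *s u' + s *s u"
    have fh: "pairing f h = 1"
      using 3 by (simp add: f_def s_def pairing_linear)
    have "0 < pairing f (g i)" if "i \<in> insert j I" for i
    proof (cases "i = j")
      case True
      then show ?thesis using fh by (simp add: h_def)
    next
      case False
      then have "i \<in> I" using that by simp
      have "pairing u (g' i) = 0"
        using 3 by (simp add: g'_def c_def pairing_linear)
      then have "pairing f (g' i) = of_nat K * pairing u' (g' i)"
        by (simp add: f_def pairing_add_left pairing_scale_left)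
      then have "pairing f (g i) = of_nat K * pairing u' (g' i) - c i"
        using fh by (simp add: g'_def pairing_add_right pairing_scale_right)
      then show ?thesis
        using K u' \<open>i \<in> I\<close> by fastforce
    qed
    then show ?thesis by blast
  qed
qed

text \<open>
  Being positive on a finite set survives a relatively small perturbation, so the finitely many
  hyperplanes orthogonal to \<open>X\<close> can be left one after the other: to leave the hyperplane of \<open>h\<close>,
  add \<open>h\<close> to a large multiple of the functional.
\<close>

lemma generic_positive_functional:
  fixes X :: "(rat ^ 'n::finite) set"
  assumes "finite A" "finite X" "0 \<notin> X" and u: "\<forall>x\<in>A. 0 < pairing u x"
  shows "\<exists>t. (\<forall>x\<in>A. 0 < pairing t x) \<and> (\<forall>x\<in>X. pairing t x \<noteq> 0)"
  using assms(2,3)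
proof (induction X rule: finite_induct)
  case empty
  show ?case using u by auto
next
  case (insert h X)
  then obtain t where tA: "\<forall>x\<in>A. 0 < pairing t x" and tX: "\<forall>x\<in>X. pairing t x \<noteq> 0"
    by auto
  show ?case
  proof (cases "pairing t h = 0")
    case False
    then show ?thesis using tA tX by auto
  next
    case True
    obtain K :: nat where K: "0 < K"
      "\<forall>x\<in>A \<union> X. 0 < \<bar>pairing t x\<bar> \<longrightarrow> \<bar>pairing h x\<bar> < of_nat K * \<bar>pairing t x\<bar>"
      using common_dominating_multiple [of "A \<union> X" "\<lambda>x. \<bar>pairing t x\<bar>" "\<lambda>x. \<bar>pairing h x\<bar>"]
        assms(1) insert.hyps(1)
      by blast
    have val: "pairing (of_nat K *s t + h) x = of_nat K * pairing t x + pairing h x" for x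
      by (simp add: pairing_linear)
    have "0 < pairing (of_nat K *s t + h) x" if "x \<in> A" for x
    proof -
      have "\<bar>pairing h x\<bar> < of_nat K * pairing t x"
        using K(2) tA that by force
      then show ?thesis unfolding val by linarith
    qed
    moreover have "pairing (of_nat K *s t + h) x \<noteq> 0" if "x \<in> X" for x
    proof -
      have "\<bar>pairing h x\<bar> < \<bar>of_nat K * pairing t x\<bar>"
        using K tX that by (auto simp: abs_mult)
      then show ?thesis unfolding val by linarith
    qed
    moreover have "pairing (of_nat K *s t + h) h \<noteq> 0"
      using True pairing_self_pos [of h] insert.prems by (auto simp: val)
    ultimately show ?thesis by blast
  qed
qed

lemma rat_cone_generator:
  assumes "finite G" "g \<in> G" "0 \<le> b"
  shows "b *s g \<in> rat_cone G"
proof -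
  have "(\<Sum>x\<in>G. (if x = g then b else 0) *s x) = (\<Sum>x\<in>G. if x = g then b *s g else 0)"
    by (intro sum.cong) auto
  then have "(\<Sum>x\<in>G. (if x = g then b else 0) *s x) = b *s g"
    using assms by simp
  then show ?thesis
    unfolding rat_cone_def using assms(3) by (auto intro!: exI [of _ "\<lambda>x. if x = g then b else 0"])
qed

lemma rat_cone_zero: "0 \<in> rat_cone G"
  unfolding rat_cone_def by (auto intro!: exI [of _ "\<lambda>_. 0"])

lemma rat_cone_add:
  assumes "x \<in> rat_cone G" "y \<in> rat_cone G"
  shows "x + y \<in> rat_cone G"
proof -
  obtain a b where "x = (\<Sum>g\<in>G. a g *s g)" "\<forall>g\<in>G. 0 \<le> a g" "y = (\<Sum>g\<in>G. b g *s g)" "\<forall>g\<in>G. 0 \<le> b g"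
    using assms unfolding rat_cone_def by blast
  then have "x + y = (\<Sum>g\<in>G. (a g + b g) *s g)" "\<forall>g\<in>G. 0 \<le> a g + b g"
    by (auto simp: vector_sadd_rdistrib sum.distrib)
  then show ?thesis
    unfolding rat_cone_def mem_Collect_eq by (intro exI [of _ "\<lambda>g. a g + b g"]) simp
qed

lemma dual_rat_cone_iff:
  assumes "finite G"
  shows "u \<in> dual_cone (rat_cone G) \<longleftrightarrow> (\<forall>g\<in>G. 0 \<le> pairing u g)"
proof
  assume u: "u \<in> dual_cone (rat_cone G)"
  show "\<forall>g\<in>G. 0 \<le> pairing u g"
    using u rat_cone_generator [OF assms, of _ 1] by (auto simp: dual_cone_def)
next
  assume "\<forall>g\<in>G. 0 \<le> pairing u g"
  then show "u \<in> dual_cone (rat_cone G)"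
    by (auto simp: dual_cone_def rat_cone_def pairing_linear intro!: sum_nonneg)
qed

lemma rat_cone_positive:
  assumes "finite G" "x \<in> rat_cone G" "x \<noteq> 0" and u: "\<forall>g\<in>G - {0}. 0 < pairing u g"
  shows "0 < pairing u x"
proof -
  obtain a where a: "x = (\<Sum>g\<in>G. a g *s g)" "\<forall>g\<in>G. 0 \<le> a g"
    using assms(2) unfolding rat_cone_def by blast
  have "\<exists>g\<in>G. a g *s g \<noteq> 0"
    using a(1) \<open>x \<noteq> 0\<close> by (meson sum.neutral)
  then obtain g where g: "g \<in> G" "a g \<noteq> 0" "g \<noteq> 0"
    by auto
  have "0 < (\<Sum>g\<in>G. a g * pairing u g)"
  proof (rule sum_pos2 [OF assms(1) g(1)])
    show "0 < a g * pairing u g"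
      using a(2) g u by (simp add: order_less_le)
    fix i assume "i \<in> G"
    then show "0 \<le> a i * pairing u i"
      using a(2) u by (cases "i = 0") (auto simp: less_imp_le)
  qed
  then show ?thesis
    by (simp add: a(1) pairing_linear)
qed

text \<open>
  In a nontrivial nonnegative relation among the nonzero generators, each term that occurs is the
  negative of the sum of the others, so the cone contains a line.
\<close>

lemma pointed_cone_positive_functional:
  assumes "finite G" and pt: "pointed (rat_cone G)"
  shows "\<exists>t. \<forall>g\<in>G - {0}. 0 < pairing t g"
proof (rule gordan)
  show "finite (G - {0})"
    using assms(1) by simp
  fix a :: "rat ^ 'a \<Rightarrow> rat"
  assume a: "\<forall>g\<in>G - {0}. 0 \<le> a g" and rel: "(\<Sum>g\<in>G - {0}. a g *s g) = 0"
  show "\<forall>g\<in>G - {0}. a g = 0"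
  proof
    fix h assume h: "h \<in> G - {0}"
    have "a h *s h \<in> rat_cone G"
      using h a assms(1) by (intro rat_cone_generator) auto
    moreover have "- (a h *s h) \<in> rat_cone G"
    proof -
      have "- (a h *s h) = (\<Sum>g\<in>G - {0} - {h}. a g *s g)"
        using rel h assms(1) by (simp add: sum_diff1)
      also have "\<dots> = (\<Sum>g\<in>G. (if g \<in> G - {0} - {h} then a g else 0) *s g)"
        using assms(1) by (intro sum.mono_neutral_cong_left) auto
      also have "\<dots> \<in> rat_cone G"
        unfolding rat_cone_def using a
        by (auto intro!: exI [of _ "\<lambda>g. if g \<in> G - {0} - {h} then a g else 0"])
      finally show ?thesis .
    qed
    ultimately have "a h *s h \<in> rat_cone G \<inter> uminus ` rat_cone G"
      by (metis IntI image_eqI minus_minus)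
    then have "a h *s h = 0"
      using pt unfolding pointed_def by blast
    then show "a h = 0"
      using h by simp
  qed
qed

text \<open>
  The functional \<open>K u + t\<close>, with \<open>t\<close> generic and \<open>K\<close> large, agrees with \<open>u\<close> wherever \<open>u\<close> already
  decides a sign and breaks every tie by \<open>t\<close>.
\<close>

lemma generic_refinement:
  fixes G D :: "(rat ^ 'n::finite) set"
  assumes G: "finite G" and pt: "pointed (rat_cone G)"
    and D: "finite D" "0 \<notin> D"
    and u: "\<forall>g\<in>G. 0 \<le> pairing (lattice_emb u) g"
  shows "\<exists>u'. (\<forall>g\<in>G - {0}. 0 < pairing (lattice_emb u') g) \<and>
     (\<forall>x\<in>D. pairing (lattice_emb u') x \<noteq> 0 \<and>
        (0 < pairing (lattice_emb u) x \<longrightarrow> 0 < pairing (lattice_emb u') x))"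
proof -
  obtain t0 where t0: "\<forall>g\<in>G - {0}. 0 < pairing t0 g"
    using pointed_cone_positive_functional [OF G pt] by blast
  obtain t1 where t1: "\<forall>g\<in>G - {0}. 0 < pairing t1 g" "\<forall>x\<in>D. pairing t1 x \<noteq> 0"
    using generic_positive_functional [OF _ D t0] G by auto
  obtain d :: int where d: "0 < d" "\<forall>i. of_int d * t1 $ i \<in> \<int>"
    using common_denominator [of UNIV "\<lambda>i. t1 $ i"] by auto
  have "\<exists>z. of_int d * t1 $ i = of_int z" for i
    using d(2) by (metis Ints_cases)
  then obtain z where z: "\<And>i. of_int d * t1 $ i = of_int (z i)"
    by metis
  define t where "t = (\<chi> i. z i)"
  have "lattice_emb t = of_int d *s t1"
    by (simp add: t_def lattice_emb_def vec_eq_iff z)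
  then have t: "pairing (lattice_emb t) x = of_int d * pairing t1 x" for x
    by (simp add: pairing_linear)
  let ?u = "\<lambda>x. pairing (lattice_emb u) x" and ?t = "\<lambda>x. pairing (lattice_emb t) x"
  obtain K :: nat where K: "0 < K" "\<forall>x\<in>D. 0 < \<bar>?u x\<bar> \<longrightarrow> \<bar>?t x\<bar> < of_nat K * \<bar>?u x\<bar>"
    using common_dominating_multiple [OF D(1), of "\<lambda>x. \<bar>?u x\<bar>" "\<lambda>x. \<bar>?t x\<bar>"] by blast
  define u' where "u' = int K *s u + t"
  have u': "pairing (lattice_emb u') x = of_nat K * ?u x + ?t x" for x
    by (simp add: u'_def lattice_emb_add lattice_emb_scale pairing_linear)
  have "0 < pairing (lattice_emb u') g" if "g \<in> G - {0}" for g
    using that u t1(1) d(1) by (simp add: u' t add_nonneg_pos)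
  moreover have "pairing (lattice_emb u') x \<noteq> 0 \<and> (0 < ?u x \<longrightarrow> 0 < pairing (lattice_emb u') x)"
    if "x \<in> D" for x
  proof (cases "?u x = 0")
    case True
    then show ?thesis
      using that t1(2) d(1) by (simp add: u' t)
  next
    case False
    then have "\<bar>?t x\<bar> < of_nat K * \<bar>?u x\<bar>"
      using K(2) that by simp
    moreover have "of_nat K * \<bar>?u x\<bar> = \<bar>of_nat K * ?u x\<bar>"
      by (simp add: abs_mult)
    moreover have "0 < ?u x \<longrightarrow> 0 < of_nat K * ?u x"
      using K(1) by simp
    ultimately show ?thesis
      unfolding u' by linarith
  qed
  ultimately show ?thesis
    by (intro exI [of _ u']) simp
qed

section \<open>Minimal faces and support values\<close>

lemma support_value_eq:
  assumes "p \<in> min_face \<Delta> u"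
  shows "support_value \<Delta> u = pairing (lattice_emb u) p"
  unfolding support_value_def
  using assms by (intro Least_equality) (auto simp: min_face_def)

lemma rat_polytope_generator:
  assumes "finite P" "p \<in> P"
  shows "p \<in> rat_polytope P"
proof -
  have "(\<Sum>x\<in>P. (if x = p then 1 else 0) *s x) = (\<Sum>x\<in>P. if x = p then p else 0)"
    by (intro sum.cong) auto
  then have "p = (\<Sum>x\<in>P. (if x = p then 1 else 0) *s x)"
    using assms by simp
  then show ?thesis
    unfolding rat_polytope_def using assms by (auto intro!: exI [of _ "\<lambda>x. if x = p then 1 else 0"])
qed

lemma generator_in_min_face:
  assumes P: "finite P" "p \<in> P" and \<Delta>: "\<Delta> = rat_polytope P + \<sigma>" and "0 \<in> \<sigma>"
    and u: "lattice_emb u \<in> dual_cone \<sigma>"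
    and min: "\<forall>q\<in>P. pairing (lattice_emb u) p \<le> pairing (lattice_emb u) q"
  shows "p \<in> min_face \<Delta> u"
proof -
  have "p \<in> \<Delta>"
    using rat_polytope_generator [OF P] \<open>0 \<in> \<sigma>\<close> set_plus_intro [of p "rat_polytope P" 0 \<sigma>]
    by (simp add: \<Delta>)
  moreover have "pairing (lattice_emb u) p \<le> pairing (lattice_emb u) v" if v_in: "v \<in> \<Delta>" for v
  proof -
    obtain x s where v: "v = x + s" "x \<in> rat_polytope P" "s \<in> \<sigma>"
      using v_in unfolding \<Delta> by (rule set_plus_elim)
    obtain a where a: "x = (\<Sum>q\<in>P. a q *s q)" "\<forall>q\<in>P. 0 \<le> a q" "(\<Sum>q\<in>P. a q) = 1"
      using v(2) unfolding rat_polytope_def by blast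
    have "pairing (lattice_emb u) p = (\<Sum>q\<in>P. a q * pairing (lattice_emb u) p)"
      by (simp add: a(3) flip: sum_distrib_right)
    also have "\<dots> \<le> (\<Sum>q\<in>P. a q * pairing (lattice_emb u) q)"
      using a(2) min by (intro sum_mono mult_left_mono) auto
    also have "\<dots> = pairing (lattice_emb u) x"
      by (simp add: a(1) pairing_linear)
    also have "\<dots> \<le> pairing (lattice_emb u) v"
      using u v by (simp add: pairing_linear dual_cone_def)
    finally show ?thesis .
  qed
  ultimately show ?thesis
    by (simp add: min_face_def)
qed

lemma min_face_nonempty:
  assumes "polyhedron_with_tail \<sigma> \<Delta>" "0 \<in> \<sigma>" "lattice_emb u \<in> dual_cone \<sigma>"
  shows "min_face \<Delta> u \<noteq> {}"
proof -
  obtain P where P: "finite P" "P \<noteq> {}" "\<Delta> = rat_polytope P + \<sigma>"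
    using assms(1) unfolding polyhedron_with_tail_def by blast
  obtain p where "p \<in> P" "\<forall>q\<in>P. pairing (lattice_emb u) p \<le> pairing (lattice_emb u) q"
    using arg_min_if_finite(1) [OF P(1,2)] arg_min_least [OF P(1,2)] by blast
  then show ?thesis
    using generator_in_min_face [OF P(1) _ P(3) assms(2,3)] by blast
qed

lemma support_value_scale:
  assumes "polyhedron_with_tail \<sigma> \<Delta>" "0 \<in> \<sigma>" "lattice_emb u \<in> dual_cone \<sigma>" "0 \<le> k"
  shows "support_value \<Delta> (k *s u) = of_int k * support_value \<Delta> u"
proof -
  obtain p where p: "p \<in> min_face \<Delta> u"
    using min_face_nonempty [OF assms(1-3)] by blast
  then have "p \<in> min_face \<Delta> (k *s u)"
    using assms(4) by (auto simp: min_face_def lattice_emb_scale pairing_linear mult_left_mono)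
  then show ?thesis
    using p by (simp add: support_value_eq lattice_emb_scale pairing_linear)
qed

lemma dual_cone_scale:
  assumes "0 < (k::int)"
  shows "lattice_emb (k *s u) \<in> dual_cone \<sigma> \<longleftrightarrow> lattice_emb u \<in> dual_cone \<sigma>"
  using assms by (simp add: dual_cone_def lattice_emb_scale pairing_linear zero_le_mult_iff)

lemma noninteger_support_value_imp_nonintegral_face:
  assumes "polyhedron_with_tail \<sigma> \<Delta>" "0 \<in> \<sigma>" "lattice_emb u \<in> dual_cone \<sigma>"
    and "support_value \<Delta> u \<notin> \<int>"
  shows "nonintegral (min_face \<Delta> u)"
  using assms(4) pairing_lattice_Ints support_value_eq
  by (fastforce simp: nonintegral_def)

section \<open>Rounding down\<close>

lemma sum_floor_eq_floor_sum:
  fixes y :: "'i \<Rightarrow> rat"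
  assumes "finite I" and one: "\<And>i j. i \<in> I \<Longrightarrow> j \<in> I \<Longrightarrow> y i \<notin> \<int> \<Longrightarrow> y j \<notin> \<int> \<Longrightarrow> i = j"
  shows "(\<Sum>i\<in>I. \<lfloor>y i\<rfloor>) = \<lfloor>\<Sum>i\<in>I. y i\<rfloor>"
proof (cases "\<exists>i\<in>I. y i \<notin> \<int>")
  case False
  then have "of_int (\<Sum>i\<in>I. \<lfloor>y i\<rfloor>) = (\<Sum>i\<in>I. y i)"
    by (auto intro!: sum.cong)
  then show ?thesis
    by (metis floor_of_int)
next
  case True
  then obtain i where i: "i \<in> I" "y i \<notin> \<int>"
    by blast
  have "(\<Sum>j\<in>I - {i}. y j) = of_int (\<Sum>j\<in>I - {i}. \<lfloor>y j\<rfloor>)"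
  proof -
    have "y j \<in> \<int>" if "j \<in> I - {i}" for j
      using one i that by blast
    then show ?thesis
      by (auto intro!: sum.cong)
  qed
  then have "(\<Sum>j\<in>I. y j) = y i + of_int (\<Sum>j\<in>I - {i}. \<lfloor>y j\<rfloor>)"
    using sum.remove [OF assms(1) i(1), of y] by simp
  then have "\<lfloor>\<Sum>j\<in>I. y j\<rfloor> = \<lfloor>y i\<rfloor> + (\<Sum>j\<in>I - {i}. \<lfloor>y j\<rfloor>)"
    by (simp only: floor_add_int)
  then show ?thesis
    using sum.remove [OF assms(1) i(1), of "\<lambda>j. \<lfloor>y j\<rfloor>"] by simp
qed

lemma sum_floor_less_floor_sum:
  fixes y :: "'i \<Rightarrow> rat"
  assumes "finite I" "i \<in> I" "j \<in> I" "i \<noteq> j" "1 \<le> frac (y i) + frac (y j)"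
  shows "(\<Sum>i\<in>I. \<lfloor>y i\<rfloor>) < \<lfloor>\<Sum>i\<in>I. y i\<rfloor>"
proof -
  have "frac (y i) + frac (y j) = (\<Sum>k\<in>{i, j}. frac (y k))"
    using assms(4) by simp
  also have "\<dots> \<le> (\<Sum>k\<in>I. frac (y k))"
    using assms by (intro sum_mono2) auto
  finally have "1 \<le> (\<Sum>k\<in>I. y k) - of_int (\<Sum>k\<in>I. \<lfloor>y k\<rfloor>)"
    using assms(5) by (simp add: frac_def sum_subtractf)
  then have "of_int ((\<Sum>k\<in>I. \<lfloor>y k\<rfloor>) + 1) \<le> (\<Sum>k\<in>I. y k)"
    by simp
  then show ?thesis
    by (subst (asm) le_floor_iff [symmetric]) linarith
qed

lemma noninteger_pairing:
  assumes "p \<notin> range lattice_emb"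
  shows "\<exists>a. pairing (lattice_emb a) p \<notin> \<int>"
proof (rule ccontr)
  assume *: "\<not> ?thesis"
  have "p $ i \<in> \<int>" for i
  proof -
    have "pairing (lattice_emb (axis i 1)) p = (\<Sum>k\<in>UNIV. if k = i then p $ k else 0)"
      unfolding pairing_def by (intro sum.cong) (auto simp: lattice_emb_def axis_def)
    then have "pairing (lattice_emb (axis i 1)) p = p $ i"
      by simp
    then show ?thesis
      using * by metis
  qed
  then have "p = lattice_emb (\<chi> i. \<lfloor>p $ i\<rfloor>)"
    by (simp add: lattice_emb_def vec_eq_iff)
  then show False
    using assms by blast
qed

text \<open>
  Pairing with \<open>p\<close> and with \<open>q\<close> gives two nontrivial homomorphisms from the lattice to \<open>\<rat>/\<int>\<close>.
  Their kernels do not cover the lattice, since a group is not the union of two proper subgroups.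
  At a point outside both kernels or at its negative the fractional parts add up to at least \<open>1\<close>.
\<close>

lemma large_fractional_parts:
  assumes "p \<notin> range lattice_emb" "q \<notin> range lattice_emb"
  shows "\<exists>a. 1 \<le> frac (pairing (lattice_emb a) p) + frac (pairing (lattice_emb a) q)"
proof -
  obtain a b where ab: "pairing (lattice_emb a) p \<notin> \<int>" "pairing (lattice_emb b) q \<notin> \<int>"
    using assms noninteger_pairing by metis
  have "\<exists>c. pairing (lattice_emb c) p \<notin> \<int> \<and> pairing (lattice_emb c) q \<notin> \<int>"
  proof (cases "pairing (lattice_emb a) q \<in> \<int> \<and> pairing (lattice_emb b) p \<in> \<int>")
    case True
    then have "pairing (lattice_emb (a + b)) p \<notin> \<int> \<and> pairing (lattice_emb (a + b)) q \<notin> \<int>"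
      using ab by (auto simp: lattice_emb_add pairing_linear)
    then show ?thesis by blast
  next
    case False
    then show ?thesis using ab by blast
  qed
  then obtain c where c: "pairing (lattice_emb c) p \<notin> \<int>" "pairing (lattice_emb c) q \<notin> \<int>"
    by blast
  have neg: "frac (pairing (lattice_emb (- c)) x) = 1 - frac (pairing (lattice_emb c) x)"
    if "pairing (lattice_emb c) x \<notin> \<int>" for x
  proof -
    have "pairing (lattice_emb (- c)) x = - pairing (lattice_emb c) x"
      by (simp only: lattice_emb_uminus pairing_scale_left mult_minus1)
    then show ?thesis
      using that by (simp add: frac_neg)
  qed
  have "1 \<le> frac (pairing (lattice_emb c) p) + frac (pairing (lattice_emb c) q) \<or>
      1 \<le> frac (pairing (lattice_emb (- c)) p) + frac (pairing (lattice_emb (- c)) q)"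
    using neg [OF c(1)] neg [OF c(2)] by linarith
  then show ?thesis by blast
qed

section \<open>Saturation and admissibility\<close>

lemma neg_floor_le_iff: "- \<lfloor>x\<rfloor> \<le> (n::int) \<longleftrightarrow> - x \<le> of_int n"
  for x :: rat
  by (metis ceiling_le_iff ceiling_minus)

text \<open>
  If \<open>(k v, k u)\<close> satisfies the rounded bounds, it satisfies the bounds without rounding, and these
  are homogeneous. The bounds for \<open>(v, u)\<close> may then be rounded again: for the lower ones because
  \<open>v\<close> is integral, for the upper one because at most one summand is not an integer.
\<close>

lemma admissible_imp_saturated:
  assumes "0 \<in> \<sigma>" and poly: "\<And>i. polyhedron_with_tail \<sigma> (\<Delta> i)"
    and adm: "admissible \<sigma> (min_indices w) \<Delta>"
  shows "saturated (S_w \<sigma> \<Delta> w idx)"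
  unfolding saturated_def
proof (intro allI impI)
  fix v u and k :: int
  assume k: "1 \<le> k" and mem: "(k *s v, k *s u) \<in> S_w \<sigma> \<Delta> w idx"
  let ?I = "min_indices w"
  have u: "lattice_emb u \<in> dual_cone \<sigma>"
    using mem k dual_cone_scale [of k u \<sigma>] by (simp add: S_w_def)
  define y where "y i = support_value (\<Delta> i) u" for i
  have scale: "support_value (\<Delta> i) (k *s u) = of_int k * y i" for i
    using support_value_scale [OF poly \<open>0 \<in> \<sigma>\<close> u] k by (simp add: y_def)
  have k': "(0::rat) < of_int k"
    using k by simp
  have "- \<lfloor>y (idx j)\<rfloor> \<le> v $ j" for j
  proof -
    have "- \<lfloor>of_int k * y (idx j)\<rfloor> \<le> k * v $ j"
      using mem by (auto simp: S_w_def scale)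
    then have "of_int k * - y (idx j) \<le> of_int k * of_int (v $ j)"
      by (simp add: neg_floor_le_iff)
    then show ?thesis
      using k' unfolding neg_floor_le_iff by (simp only: mult_le_cancel_left_pos)
  qed
  moreover have "(\<Sum>j\<in>UNIV. v $ j) \<le> (\<Sum>i\<in>?I. \<lfloor>y i\<rfloor>)"
  proof -
    have "k * (\<Sum>j\<in>UNIV. v $ j) \<le> (\<Sum>i\<in>?I. \<lfloor>of_int k * y i\<rfloor>)"
      using mem by (simp add: S_w_def scale sum_distrib_left)
    then have "of_int k * of_int (\<Sum>j\<in>UNIV. v $ j) \<le> (\<Sum>i\<in>?I. of_int \<lfloor>of_int k * y i\<rfloor> :: rat)"
      by (metis of_int_le_iff of_int_mult of_int_sum)
    also have "\<dots> \<le> (\<Sum>i\<in>?I. of_int k * y i)"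
      by (intro sum_mono) simp
    also have "\<dots> = of_int k * (\<Sum>i\<in>?I. y i)"
      by (simp add: sum_distrib_left)
    finally have "of_int (\<Sum>j\<in>UNIV. v $ j) \<le> (\<Sum>i\<in>?I. y i)"
      using k' by (simp only: mult_le_cancel_left_pos)
    then have "(\<Sum>j\<in>UNIV. v $ j) \<le> \<lfloor>\<Sum>i\<in>?I. y i\<rfloor>"
      by (simp only: le_floor_iff)
    also have "\<dots> = (\<Sum>i\<in>?I. \<lfloor>y i\<rfloor>)"
    proof (rule sum_floor_eq_floor_sum [symmetric])
      fix i j assume "i \<in> ?I" "j \<in> ?I" "y i \<notin> \<int>" "y j \<notin> \<int>"
      then show "i = j"
        using adm u noninteger_support_value_imp_nonintegral_face [OF poly \<open>0 \<in> \<sigma>\<close> u]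
        unfolding admissible_def y_def by blast
    qed simp
    finally show ?thesis .
  qed
  ultimately show "(v, u) \<in> S_w \<sigma> \<Delta> w idx"
    using u by (simp add: S_w_def y_def)
qed

text \<open>
  At a degree \<open>u\<close> where the sum of all the support values is large, there is room for a \<open>v\<close> whose
  coordinate sum is the rounded sum over the index set, although every coordinate is bounded from below.
  A multiple of \<open>(v, u)\<close> clearing the denominators lies in \<open>S\<^sub>w\<close>, so saturation forces \<open>(v, u)\<close>
  into it as well.
\<close>

lemma saturated_imp_floor_sum_le:
  fixes idx :: "'c::finite \<Rightarrow> 'm::finite option"
  assumes "0 \<in> \<sigma>" and poly: "\<And>i. polyhedron_with_tail \<sigma> (\<Delta> i)"
    and sat: "saturated (S_w \<sigma> \<Delta> w idx)"
    and idx: "bij_betw idx UNIV (UNIV - min_indices w)"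
    and u: "lattice_emb u \<in> dual_cone \<sigma>"
    and large: "of_nat CARD('c) + 1 \<le> (\<Sum>i\<in>UNIV. support_value (\<Delta> i) u)"
  shows "\<lfloor>\<Sum>i\<in>min_indices w. support_value (\<Delta> i) u\<rfloor> \<le> (\<Sum>i\<in>min_indices w. \<lfloor>support_value (\<Delta> i) u\<rfloor>)"
proof -
  let ?I = "min_indices w"
  define y where "y i = support_value (\<Delta> i) u" for i
  define T where "T = \<lfloor>\<Sum>i\<in>?I. y i\<rfloor>"
  define F where "F = (\<Sum>j\<in>UNIV. \<lfloor>y (idx j)\<rfloor>)"
  \<comment> \<open>Every coordinate is given its least allowed value, and an arbitrary one, \<open>j0\<close>, takes up the
    difference to the prescribed coordinate sum \<open>T\<close>.\<close>
  fix j0 :: 'c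
  define v where "v = (\<chi> j. - \<lfloor>y (idx j)\<rfloor> + (if j = j0 then T + F else 0))"
  have sum_v: "(\<Sum>j\<in>UNIV. v $ j) = T"
    by (simp add: v_def sum_subtractf F_def)
  have le_floor_plus_1: "y i \<le> of_int \<lfloor>y i\<rfloor> + 1" for i
    using floor_correct [of "y i"] unfolding of_int_add of_int_1 by linarith
  have "0 \<le> T + F"
  proof -
    have "(\<Sum>i\<in>UNIV. y i) = (\<Sum>i\<in>?I. y i) + (\<Sum>i\<in>UNIV - ?I. y i)"
      by (simp add: sum.subset_diff [of ?I UNIV] add.commute)
    also have "(\<Sum>i\<in>UNIV - ?I. y i) = (\<Sum>j\<in>UNIV. y (idx j))"
      using sum.reindex_bij_betw [OF idx, of y] by simp
    \<comment> \<open>Rounding loses at most \<open>1\<close> in each of the \<open>c\<close> coordinates and \<open>1\<close> in \<open>T\<close>, which is where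
      the bound \<open>c + 1\<close> comes from.\<close>
    also have "\<dots> \<le> (\<Sum>j\<in>UNIV. of_int \<lfloor>y (idx j)\<rfloor> + 1)"
      by (intro sum_mono le_floor_plus_1)
    also have "\<dots> = of_int F + of_nat CARD('c)"
      by (simp add: F_def sum.distrib)
    finally have "of_nat CARD('c) + 1 \<le> (\<Sum>i\<in>?I. y i) + (of_int F + of_nat CARD('c))"
      using large unfolding y_def by linarith
    moreover have "(\<Sum>i\<in>?I. y i) < of_int T + 1"
      using floor_correct [of "\<Sum>i\<in>?I. y i"] unfolding T_def of_int_add of_int_1 by blast
    ultimately have "(0::rat) < of_int (T + F)"
      by simp
    then show ?thesis by simp
  qed
  then have v_ge: "- \<lfloor>y (idx j)\<rfloor> \<le> v $ j" for j
    by (simp add: v_def)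
  obtain k :: int where k: "0 < k" "\<forall>i\<in>?I. of_int k * y i \<in> \<int>"
    using common_denominator [of ?I y] by auto
  have scale: "support_value (\<Delta> i) (k *s u) = of_int k * y i" for i
    using support_value_scale [OF poly \<open>0 \<in> \<sigma>\<close> u] k by (simp add: y_def)
  have "(k *s v, k *s u) \<in> S_w \<sigma> \<Delta> w idx"
  proof -
    have "of_int (k * T) \<le> of_int k * (\<Sum>i\<in>?I. y i)"
      using k(1) by (simp add: T_def)
    also have "\<dots> = of_int (\<Sum>i\<in>?I. \<lfloor>of_int k * y i\<rfloor>)"
      using k(2) by (simp add: sum_distrib_left)
    finally have "k * T \<le> (\<Sum>i\<in>?I. \<lfloor>of_int k * y i\<rfloor>)"
      by (simp only: of_int_le_iff)
    moreover have "(\<Sum>j\<in>UNIV. (k *s v) $ j) = k * T"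
      by (simp add: sum_v flip: sum_distrib_left)
    moreover have "- \<lfloor>of_int k * y (idx j)\<rfloor> \<le> (k *s v) $ j" for j
    proof -
      have "of_int k * - y (idx j) \<le> of_int k * of_int (v $ j)"
        using v_ge [of j] k(1) unfolding neg_floor_le_iff by (intro mult_left_mono) auto
      then show ?thesis
        by (simp add: neg_floor_le_iff)
    qed
    ultimately show ?thesis
      using u k(1) by (simp add: S_w_def scale dual_cone_scale)
  qed
  then have "(v, u) \<in> S_w \<sigma> \<Delta> w idx"
    using sat k(1) unfolding saturated_def by (metis int_one_le_iff_zero_less)
  then show ?thesis
    using sum_v by (simp add: S_w_def T_def y_def)
qed

text \<open>
  The Minkowski sum is stable under adding elements of the tail cone, so it would be all of
  \<open>\<sigma>\<close> if it contained \<open>0\<close>.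
\<close>

lemma zero_notin_Minkowski_sum:
  fixes \<Delta> :: "'i::finite \<Rightarrow> (rat ^ 'n::finite) set"
  assumes poly: "\<And>i. polyhedron_with_tail \<sigma> (\<Delta> i)"
    and add: "\<And>x y. x \<in> \<sigma> \<Longrightarrow> y \<in> \<sigma> \<Longrightarrow> x + y \<in> \<sigma>"
    and proper: "(\<Sum>i\<in>UNIV. \<Delta> i) \<subset> \<sigma>"
  shows "0 \<notin> (\<Sum>i\<in>UNIV. \<Delta> i)"
proof
  assume "0 \<in> (\<Sum>i\<in>UNIV. \<Delta> i)"
  then obtain x where x: "(\<Sum>i\<in>UNIV. x i) = 0" "\<forall>i. x i \<in> \<Delta> i"
    by (auto simp: set_sum_alt)
  fix i0 :: 'i
  have "s \<in> (\<Sum>i\<in>UNIV. \<Delta> i)" if "s \<in> \<sigma>" for s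
  proof -
    have "x i0 + s \<in> \<Delta> i0"
    proof -
      obtain P where P: "\<Delta> i0 = rat_polytope P + \<sigma>"
        using poly unfolding polyhedron_with_tail_def by blast
      obtain p r where pr: "x i0 = p + r" "p \<in> rat_polytope P" "r \<in> \<sigma>"
        using x(2) P by (metis set_plus_elim)
      have "p + (r + s) \<in> rat_polytope P + \<sigma>"
        using pr add that by (intro set_plus_intro) auto
      then show ?thesis
        by (simp add: P pr add.assoc)
    qed
    then have "\<forall>i. x i + (if i = i0 then s else 0) \<in> \<Delta> i"
      using x(2) by auto
    moreover have "s = (\<Sum>i\<in>UNIV. x i + (if i = i0 then s else 0))"
      using x(1) by (simp add: sum.distrib)
    ultimately show ?thesis
      unfolding set_sum_alt [OF finite] by blast
  qed
  then show False
    using proper by blast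
qed

text \<open>
  Non-integrality of a face is not visible in the support value at \<open>u\<close> itself: a face without
  lattice points may well have an integral support value. The proof therefore passes to vertices of the
  two faces and to degrees near the ray of \<open>u\<close> in which these vertices have non-integral pairings.
\<close>

lemma saturated_imp_admissible:
  fixes \<sigma> :: "(rat ^ 'n::finite) set" and idx :: "'c::finite \<Rightarrow> 'm::finite option"
  assumes "polyhedral_cone \<sigma>" and pt: "pointed \<sigma>"
    and poly: "\<And>i. polyhedron_with_tail \<sigma> (\<Delta> i)"
    and proper: "(\<Sum>i\<in>UNIV. \<Delta> i) \<subset> \<sigma>"
    and idx: "bij_betw idx UNIV (UNIV - min_indices w)"
    and sat: "saturated (S_w \<sigma> \<Delta> w idx)"
  shows "admissible \<sigma> (min_indices w) \<Delta>"
  unfolding admissible_def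
proof (intro allI impI ballI)
  fix u i j
  let ?I = "min_indices w"
  let ?pair = "\<lambda>u. pairing (lattice_emb u)"
  assume u: "lattice_emb u \<in> dual_cone \<sigma>" and ij: "i \<in> ?I" "j \<in> ?I"
    and nonint: "nonintegral (min_face (\<Delta> i) u)" "nonintegral (min_face (\<Delta> j) u)"
  show "i = j"
  proof (rule ccontr)
    assume "i \<noteq> j"
    obtain G where G: "finite G" "\<sigma> = rat_cone G"
      using assms(1) unfolding polyhedral_cone_def by blast
    have zero: "0 \<in> \<sigma>"
      by (simp add: G rat_cone_zero)
    have dual: "x \<in> dual_cone \<sigma> \<longleftrightarrow> (\<forall>g\<in>G. 0 \<le> pairing x g)" for x
      using dual_rat_cone_iff [OF G(1)] by (simp add: G(2))
    obtain P where P: "\<And>k. finite (P k)" "\<And>k. P k \<noteq> {}" "\<And>k. \<Delta> k = rat_polytope (P k) + \<sigma>"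
      using poly unfolding polyhedron_with_tail_def by metis
    \<comment> \<open>Separating the generators of every polyhedron means not vanishing on their differences.\<close>
    define D where "D = (\<Union>k. (\<lambda>(p, q). q - p) ` (P k \<times> P k)) - {0}"
    have D: "finite D" "0 \<notin> D"
      using P(1) by (auto simp: D_def)
    have in_D: "q - p \<in> D" if "p \<in> P k" "q \<in> P k" "p \<noteq> q" for p q k
      using that by (auto simp: D_def)
    obtain u' where u'G: "\<forall>g\<in>G - {0}. 0 < ?pair u' g"
      and u'D: "\<forall>x\<in>D. ?pair u' x \<noteq> 0 \<and> (0 < ?pair u x \<longrightarrow> 0 < ?pair u' x)"
      using generic_refinement [OF G(1) _ D, of u] pt u dual by (auto simp: G(2))
    have "\<exists>p\<in>P k. \<forall>q\<in>P k. ?pair u' p \<le> ?pair u' q" for k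
      using arg_min_if_finite(1) [OF P(1,2)] arg_min_least [OF P(1,2)] by blast
    then obtain p where p: "\<And>k. p k \<in> P k" "\<And>k q. q \<in> P k \<Longrightarrow> ?pair u' (p k) \<le> ?pair u' q"
      by metis
    have strict: "0 < ?pair u' (q - p k)" if "q \<in> P k" "q \<noteq> p k" for q k
    proof -
      have "?pair u' (q - p k) \<noteq> 0"
        using u'D in_D p(1) that by metis
      then show ?thesis
        using p(2) [OF that(1)] by (simp add: pairing_linear)
    qed
    \<comment> \<open>The refined functional selects vertices of the faces cut out by the original one.\<close>
    have p_face: "p k \<in> min_face (\<Delta> k) u" for k
    proof (rule generator_in_min_face [OF P(1) p(1) P(3) zero u], intro ballI, rule ccontr)
      fix q assume q: "q \<in> P k" and "\<not> ?pair u (p k) \<le> ?pair u q"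
      then have less: "0 < ?pair u (p k - q)" "q \<noteq> p k"
        by (auto simp: pairing_linear)
      then have "0 < ?pair u' (p k - q)"
        using u'D in_D [OF q p(1)] by auto
      then show False
        using p(2) [OF q] by (simp add: pairing_linear)
    qed
    have "p i \<notin> range lattice_emb" "p j \<notin> range lattice_emb"
      using nonint p_face by (auto simp: nonintegral_def)
    then obtain a where a: "1 \<le> frac (?pair a (p i)) + frac (?pair a (p j))"
      using large_fractional_parts by blast
    define s where "s = (\<Sum>k\<in>UNIV. p k)"
    have "s \<in> (\<Sum>k\<in>UNIV. \<Delta> k)"
      unfolding s_def set_sum_alt [OF finite] using p_face by (auto simp: min_face_def)
    moreover have "0 \<notin> (\<Sum>k\<in>UNIV. \<Delta> k)"
      by (rule zero_notin_Minkowski_sum [OF poly _ proper]) (auto simp: G(2) rat_cone_add)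
    ultimately have s: "s \<in> \<sigma>" "s \<noteq> 0"
      using proper by auto
    have s_pos: "0 < ?pair u' s"
      using rat_cone_positive [OF G(1) _ s(2) u'G] s(1) by (simp add: G(2))
    obtain d :: int where d: "0 < d" "\<forall>k\<in>UNIV. of_int d * ?pair u' (p k) \<in> \<int>"
      using common_denominator [of UNIV "\<lambda>k. ?pair u' (p k)"] by auto
    \<comment> \<open>The vectors whose pairings decide which vertices are selected, whether the functional lies
      in the dual cone, and how large the sum of all support values is.\<close>
    define E where "E = insert s (D \<union> G)"
    obtain K :: nat where K: "\<forall>x\<in>E. 0 < of_int d * ?pair u' x \<longrightarrow>
        of_nat CARD('c) + 1 - ?pair a x < of_nat K * (of_int d * ?pair u' x)"
      using common_dominating_multiple [of E "\<lambda>x. of_int d * ?pair u' x"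
        "\<lambda>x. of_nat CARD('c) + 1 - ?pair a x"] D(1) G(1) by (auto simp: E_def)
    \<comment> \<open>Adding a large multiple of \<open>d u'\<close> moves \<open>a\<close> into the open cone of functionals selecting the
      vertices \<open>p k\<close> and changes the pairings with them by integers only.\<close>
    define z where "z = a + (int K * d) *s u'"
    have z: "?pair z x = ?pair a x + of_nat K * (of_int d * ?pair u' x)" for x
      by (simp add: z_def lattice_emb_add lattice_emb_scale pairing_linear)
    have z_large: "of_nat CARD('c) + 1 < ?pair z x" if "x \<in> E" "0 < ?pair u' x" for x
      using K that d(1) by (fastforce simp: z)
    have z_pos: "0 < ?pair z x" if "x \<in> E" "0 < ?pair u' x" for x
      by (rule less_trans [OF _ z_large [OF that]]) (simp add: add_nonneg_pos)
    have z_dual: "lattice_emb z \<in> dual_cone \<sigma>"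
      unfolding dual
    proof
      fix g assume "g \<in> G"
      then show "0 \<le> ?pair z g"
        using z_pos [of g] u'G by (cases "g = 0") (auto simp: E_def intro: less_imp_le)
    qed
    have "p k \<in> min_face (\<Delta> k) z" for k
    proof (rule generator_in_min_face [OF P(1) p(1) P(3) zero z_dual], intro ballI)
      fix q assume q: "q \<in> P k"
      show "?pair z (p k) \<le> ?pair z q"
      proof (cases "q = p k")
        case False
        then have "0 < ?pair z (q - p k)"
          using q in_D [OF p(1) q] strict by (intro z_pos) (auto simp: E_def)
        then show ?thesis
          by (simp add: pairing_linear)
      qed simp
    qed
    then have sv: "support_value (\<Delta> k) z = ?pair z (p k)" for k
      by (rule support_value_eq)
    have "(\<Sum>k\<in>UNIV. support_value (\<Delta> k) z) = ?pair z s"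
      by (simp add: sv s_def pairing_sum_right)
    then have "of_nat CARD('c) + 1 \<le> (\<Sum>k\<in>UNIV. support_value (\<Delta> k) z)"
      using z_large [of s] s_pos by (simp add: E_def)
    then have "\<lfloor>\<Sum>k\<in>?I. support_value (\<Delta> k) z\<rfloor> \<le> (\<Sum>k\<in>?I. \<lfloor>support_value (\<Delta> k) z\<rfloor>)"
      by (rule saturated_imp_floor_sum_le [OF zero poly sat idx z_dual])
    moreover have "frac (support_value (\<Delta> k) z) = frac (?pair a (p k))" for k
    proof -
      have "of_nat K * (of_int d * ?pair u' (p k)) \<in> \<int>"
        using d(2) by (intro Ints_mult [OF Ints_of_nat]) blast
      then obtain n where "of_nat K * (of_int d * ?pair u' (p k)) = of_int n"
        by (metis Ints_cases)
      then show ?thesis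
        by (simp add: sv z frac_def)
    qed
    then have "(\<Sum>k\<in>?I. \<lfloor>support_value (\<Delta> k) z\<rfloor>) < \<lfloor>\<Sum>k\<in>?I. support_value (\<Delta> k) z\<rfloor>"
      using a ij \<open>i \<noteq> j\<close> by (intro sum_floor_less_floor_sum [of _ i j]) auto
    ultimately show False by linarith
  qed
qed

theorem proposition5p8:
  fixes \<sigma> :: "(rat ^ 'n::finite) set"
    and \<Delta> :: "'m::finite option \<Rightarrow> (rat ^ 'n) set"
    and l :: "'m option \<Rightarrow> complex ^ 'c::finite option"
    and \<tau> :: "(real ^ 'm) set"
    and w :: "real ^ 'm"
    and idx :: "'c \<Rightarrow> 'm option"
  assumes "polyhedral_cone \<sigma>" and "pointed \<sigma>"
    and "\<And>i. polyhedron_with_tail \<sigma> (\<Delta> i)"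
    and "(\<Sum>i\<in>UNIV. \<Delta> i) \<subset> \<sigma>"
    and "full_rank l" and "general_position l"
    and "maximal_trop_cone l \<tau>"
    and "w \<in> rel_interior \<tau>"
    and "bij_betw idx UNIV (UNIV - min_indices w)"
  shows "saturated (S_w \<sigma> \<Delta> w idx) \<longleftrightarrow> admissible \<sigma> (min_indices w) \<Delta>"
proof
  assume "saturated (S_w \<sigma> \<Delta> w idx)"
  then show "admissible \<sigma> (min_indices w) \<Delta>"
    using assms by (intro saturated_imp_admissible [where idx = idx]) auto
next
  assume "admissible \<sigma> (min_indices w) \<Delta>"
  moreover have "0 \<in> \<sigma>"
    using assms(2) by (auto simp: pointed_def)
  ultimately show "saturated (S_w \<sigma> \<Delta> w idx)"
    using assms(3) by (intro admissible_imp_saturated)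
qed

end
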